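(* Let $U_1,\dots,U_n$ be $n\ge 1$ i.i.d. random variables uniformly distributed on $(0,1)$, and let $\kappa=\pi^2/6$. For all $\delta\in(0,1)$, with probability at least $1-\delta$, $$\forall t\in(0,1),\quad n^{-1}\sum_{i=1}^n \mathbf 1\{U_i\le t\}\le t\,h^{-1}\!\left(\frac{\log(\kappa/\delta)+2\log(\lceil\log_2(1/t)\rceil)}{n\,g(t)}\right),$$ where $g(t)=2^{-\lceil\log_2(1/t)\rceil}/\bigl(1-2^{-\lceil\log_2(1/t)\rceil}\bigr)\ge t/2$. In particular, with probability at least $1-\delta$, $$\forall t\in(0,1),\quad n^{-1}\sum_{i=1}^n \mathbf 1\{U_i\le t\}\le t\,h^{-1}\!\left(\frac{2\log(\kappa/\delta)+4\log(1+\log_2(1/t))}{n\,t}\right).$$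
   Context: The function $h$ is defined by $h(\lambda)=\lambda(\log\lambda-1)+1$ for $\lambda>1$; it is an increasing bijection from $(1,\infty)$ onto $(0,\infty)$, and $h^{-1}:(0,\infty)\to(1,\infty)$ is its inverse. $\log$ is the natural logarithm and $\log_2$ the base-2 logarithm. *)

theory Defs
  imports "HOL-Probability.Probability"
begin

definition h :: "real \<Rightarrow> real" where
  "h l = l * (ln l - 1) + 1"

text \<open>The function \<open>h\<close> is only considered on \<open>(1,\<infinity>)\<close>; outside \<open>(0,\<infinity>)\<close> the value of
  \<open>h_inv\<close> is unspecified.\<close>

definition h_inv :: "real \<Rightarrow> real" where
  "h_inv = the_inv_into {1<..} h"

definition kappa :: real where
  "kappa = pi\<^sup>2 / 6"

definition dyadic_level :: "real \<Rightarrow> int" where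
  "dyadic_level t = \<lceil>log 2 (1 / t)\<rceil>"

definition g :: "real \<Rightarrow> real" where
  "g t = 2 powr (- real_of_int (dyadic_level t)) / (1 - 2 powr (- real_of_int (dyadic_level t)))"

lemma h_strict_mono_on: "strict_mono_on {1<..} h"
proof (rule strict_mono_onI)
  fix a b :: real assume ab: "a \<in> {1<..}" "b \<in> {1<..}" "a < b"
  show "h a < h b"
  proof (rule DERIV_pos_imp_increasing[OF \<open>a < b\<close>])
    fix x assume "a \<le> x" "x \<le> b"
    with ab have "1 < x" by simp
    then have "(h has_real_derivative ln x) (at x)"
      unfolding h_def[abs_def] by (auto intro!: derivative_eq_intros)
    with \<open>1 < x\<close> show "\<exists>y. (h has_real_derivative y) (at x) \<and> 0 < y"
      by (intro exI[of _ "ln x"]) simp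
  qed
qed

lemma h_pos: assumes "1 < x" shows "0 < h x"
proof -
  have "ln (1 / x) < 1 / x - 1"
    using assms ln_le_minus_one[of "1 / x"] ln_eq_minus_one[of "1 / x"] by fastforce
  then have "x * (1 - 1 / x) < x * ln x"
    using assms by (intro mult_strict_left_mono) (auto simp: ln_div)
  then show ?thesis using assms by (simp add: h_def algebra_simps)
qed

lemma h_bij_betw: "bij_betw h {1<..} {0<..}"
proof (rule bij_betw_imageI)
  show "inj_on h {1<..}"
    by (rule strict_mono_on_imp_inj_on[OF h_strict_mono_on])
  show "h ` {1<..} = {0<..}"
  proof (intro equalityI subsetI)
    fix y assume "y \<in> h ` {1<..}"
    then show "y \<in> {0<..}" using h_pos by auto
  next
    fix y :: real assume "y \<in> {0<..}"
    then have y: "0 < y" by simp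
    define b where "b = exp (1 + y)"
    have b: "1 < b" "y < h b"
    proof -
      show "1 < b" using y by (simp add: b_def)
      then have "y * 1 < y * b" using y by (intro mult_strict_left_mono)
      then show "y < h b" by (simp add: h_def b_def mult.commute)
    qed
    have "\<exists>x\<ge>1. x \<le> b \<and> h x = y"
    proof (rule IVT')
      show "h 1 \<le> y" using y by (simp add: h_def)
      show "continuous_on {1..b} h"
        unfolding h_def[abs_def] by (intro continuous_intros) auto
    qed (use b in auto)
    then obtain x where x: "1 \<le> x" "h x = y" by blast
    moreover have "x \<noteq> 1" using x y by (auto simp: h_def)
    ultimately show "y \<in> h ` {1<..}" by force
  qed
qed

end

theory Submission
  imports Defs
begin

text \<open>
  Let \<open>N t\<close> be the number of sample points in \<open>(0,t]\<close>. As \<open>t\<close> decreases, \<open>N t / t\<close> is a martingale, so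
  Doob's inequality for the submartingale \<open>exp (s N t / t)\<close> bounds the probability that
  \<open>N t / t\<close> exceeds \<open>n l\<close> somewhere on \<open>[a,1)\<close> by \<open>exp (-s n l) E (exp (s N a / a))\<close>. With Bennett's bound
  for the binomial moment generating function and \<open>s = a ln l / (1 - a)\<close> this is
  at most \<open>exp (- n a h l / (1 - a))\<close>. Taking \<open>a = 2^-k\<close> and choosing \<open>l\<close> so that the bound equals
  \<open>\<delta> / (\<kappa> k^2)\<close>, a union bound over \<open>k \<ge> 1\<close> concludes, since \<open>\<Sum> 1 / k^2 = \<kappa>\<close>.

  Doob's inequality is proved directly on finite grids, by decomposing with respect to the largest
  grid point \<open>t\<close> at which the level is exceeded and the value of \<open>N t\<close>, and using \<open>exp y \<ge> 1 + y\<close> in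
  place of Jensen's inequality.
\<close>

section \<open>Comparison of two moment generating functions\<close>

text \<open>The quotient \<open>G\<close> of the two sides is 1 at 0, so it suffices that it does
  not increase. Up to a positive factor its derivative is
  \<open>exp (y / (1 - a)) - exp y * D y\<close>, which is at most 0 by convexity of
  \<open>exp\<close> between 0 and \<open>y / (1 - a)\<close>.\<close>

lemma bernoulli_mgf_le_poisson_mgf:
  fixes a x :: real
  assumes a: "0 < a" "a < 1" and x: "0 \<le> x"
  shows "1 - a + a * exp (x / (1 - a)) \<le> exp (a / (1 - a) * (exp x - 1))"
proof -
  define c where "c = a / (1 - a)"
  define D where "D y = 1 - a + a * exp (y / (1 - a))" for y
  define G where "G y = D y * exp (- (c * (exp y - 1)))" for y
  have c: "c > 0" using a by (simp add: c_def)
  have "G x \<le> G 0"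
  proof (rule DERIV_nonpos_imp_nonincreasing[OF x])
    fix y :: real assume "0 \<le> y"
    let ?d = "c * exp (- (c * (exp y - 1))) * (exp (y / (1 - a)) - exp y * D y)"
    have "(D has_real_derivative c * exp (y / (1 - a))) (at y)"
      unfolding D_def[abs_def] using a by (auto intro!: derivative_eq_intros simp: c_def)
    then have "(G has_real_derivative ?d) (at y)"
      unfolding G_def[abs_def] by (auto intro!: derivative_eq_intros simp: algebra_simps)
    moreover have "?d \<le> 0"
    proof -
      have "exp ((1 - a) *\<^sub>R 0 + a *\<^sub>R (y / (1 - a))) \<le> (1 - a) * exp 0 + a * exp (y / (1 - a))"
        using exp_convex a by (intro convex_onD) auto
      then have "exp (a * y / (1 - a)) \<le> D y"
        by (simp add: D_def)
      then have "exp y * exp (a * y / (1 - a)) \<le> exp y * D y"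
        by simp
      moreover have "y + a * y / (1 - a) = y / (1 - a)"
        using a by (simp add: field_simps)
      ultimately have "exp (y / (1 - a)) \<le> exp y * D y"
        by (simp flip: exp_add)
      then show ?thesis
        using c by (intro mult_nonneg_nonpos) auto
    qed
    ultimately show "\<exists>z. (G has_real_derivative z) (at y) \<and> z \<le> 0"
      by blast
  qed
  then have "D x * exp (- (c * (exp x - 1))) \<le> 1"
    by (simp add: G_def D_def)
  then have "D x \<le> exp (c * (exp x - 1))"
    by (simp only: exp_minus) (simp add: field_simps)
  then show ?thesis
    by (simp add: D_def c_def)
qed

section \<open>Counts of a uniform sample and their thinning\<close>

locale uniform_sample = prob_space M
  for M :: "'a measure" +
  fixes U :: "'i \<Rightarrow> 'a \<Rightarrow> real" and I :: "'i set"
  assumes finite_index: "finite I"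
    and indep: "indep_vars (\<lambda>_. borel) U I"
    and uniform: "\<And>i. i \<in> I \<Longrightarrow> distr M borel (U i) = uniform_measure lborel {0<..<1}"
begin

definition cnt :: "real \<Rightarrow> 'a \<Rightarrow> real" where
  "cnt t \<omega> = (\<Sum>i\<in>I. indicator {..t} (U i \<omega>))"

lemma random_variable_U [measurable]: "i \<in> I \<Longrightarrow> random_variable borel (U i)"
  using indep by (simp add: indep_vars_def)

lemma cnt_measurable [measurable]: "cnt t \<in> borel_measurable M"
  unfolding cnt_def by measurable

lemma cnt_eq_card: "cnt t \<omega> = real (card {i\<in>I. U i \<omega> \<le> t})"
  using finite_index by (simp add: cnt_def indicator_def sum.If_cases Int_def)

lemma cnt_mono: "s \<le> t \<Longrightarrow> cnt s \<omega> \<le> cnt t \<omega>"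
  unfolding cnt_def by (intro sum_mono) (auto simp: indicator_def)

text \<open>Only finitely many values occur; this bounds the exponential of the count and later
  makes the splitting by its value finite.\<close>

lemma cnt_cases: obtains m where "m \<le> card I" "cnt t \<omega> = real m"
proof
  show "card {i\<in>I. U i \<omega> \<le> t} \<le> card I"
    using finite_index by (intro card_mono) auto
qed (rule cnt_eq_card)

lemma prob_U_le:
  assumes i: "i \<in> I" and t: "0 < t" "t < 1"
  shows "prob {\<omega>\<in>space M. U i \<omega> \<le> t} = t"
proof -
  have "prob {\<omega>\<in>space M. U i \<omega> \<le> t} = measure (distr M borel (U i)) {..t}"
    using i by (subst measure_distr) (auto intro!: arg_cong[where f = prob])
  also have "\<dots> = measure lborel ({0<..<1} \<inter> {..t})"
    using uniform[OF i] by simp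
  also have "{0<..<1} \<inter> {..t} = {0<..t}"
    using t by auto
  finally show ?thesis
    using t by simp
qed

text \<open>On \<open>U i \<le> t\<close> the counts at levels from \<open>t\<close> upwards depend only on the other variables,
  hence the location of \<open>U i\<close> below \<open>t\<close> is independent of them.\<close>

lemma prob_thinning:
  fixes m :: real and c :: "real \<Rightarrow> real"
  assumes i: "i \<in> I" and a: "0 < a" "a \<le> t" and t: "t < 1"
    and T: "finite T" "T \<subseteq> {t..}"
  defines "A \<equiv> {\<omega>\<in>space M. cnt t \<omega> = m \<and> (\<forall>u\<in>T. cnt u \<omega> \<le> c u)}"
  shows "t * prob ({\<omega>\<in>space M. U i \<omega> \<le> a} \<inter> A) = a * prob ({\<omega>\<in>space M. U i \<omega> \<le> t} \<inter> A)"
proof -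
  define J where "J = I - {i}"
  have J: "finite J" "{i} \<inter> J = {}" "J \<subseteq> I"
    using finite_index by (auto simp: J_def)
  \<comment> \<open>\<open>cj u v\<close> is the count at level \<open>u\<close> as a function of
    the other coordinates; the leading 1 is the contribution of \<open>U i\<close>, valid when
    \<open>U i \<omega> \<le> t \<le> u\<close>.\<close>
  define cj :: "real \<Rightarrow> ('i \<Rightarrow> real) \<Rightarrow> real"
    where "cj u v = 1 + (\<Sum>j\<in>J. indicator {..u} (v j))" for u v
  have [measurable]: "cj u \<in> borel_measurable (PiM J (\<lambda>_. borel))" for u
    unfolding cj_def by measurable
  define B where "B = {v \<in> space (PiM J (\<lambda>_. borel)). cj t v = m \<and> (\<forall>u\<in>T. cj u v \<le> c u)}"
  have B: "B \<in> sets (PiM J (\<lambda>_. borel))"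
    unfolding B_def using T(1) by measurable
  define V where "V \<omega> = restrict (\<lambda>j. U j \<omega>) J" for \<omega>
  have cnt_cj: "cnt u \<omega> = cj u (V \<omega>)" if "U i \<omega> \<le> t" "t \<le> u" for u \<omega>
    using that i finite_index
    by (simp add: cnt_def cj_def V_def J_def sum.remove[of I i] cong: sum.cong_simp)
  have V_space: "V \<omega> \<in> space (PiM J (\<lambda>_. borel))" for \<omega>
    by (simp add: V_def space_PiM)
  have ind: "indep_var (PiM {i} (\<lambda>_. borel)) (\<lambda>\<omega>. restrict (\<lambda>j. U j \<omega>) {i}) (PiM J (\<lambda>_. borel)) V"
    unfolding V_def using i J by (intro indep_var_restrict[OF indep]) auto
  \<comment> \<open>The second factor does not depend on \<open>s\<close>; the cases
    \<open>s = a\<close> and \<open>s = t\<close> together give the claim.\<close>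
  have eq: "prob ({\<omega>\<in>space M. U i \<omega> \<le> s} \<inter> A) = s * prob (V -` B \<inter> space M)"
    if s: "0 < s" "s \<le> t" for s
  proof -
    define C where "C = {v \<in> space (PiM {i} (\<lambda>_. borel :: real measure)). v i \<le> s}"
    have C: "C \<in> sets (PiM {i} (\<lambda>_. borel))"
      unfolding C_def by measurable
    have "{\<omega>\<in>space M. U i \<omega> \<le> s} \<inter> A
        = (\<lambda>\<omega>. (restrict (\<lambda>j. U j \<omega>) {i}, V \<omega>)) -` (C \<times> B) \<inter> space M"
    proof (rule set_eqI)
      fix \<omega>
      have "(\<omega> \<in> A) = (V \<omega> \<in> B)" if "U i \<omega> \<le> t" "\<omega> \<in> space M"
        using that T(2) V_space[of \<omega>] by (auto simp: A_def B_def cnt_cj subset_eq)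
      then show "(\<omega> \<in> {\<omega>\<in>space M. U i \<omega> \<le> s} \<inter> A)
          = (\<omega> \<in> (\<lambda>\<omega>. (restrict (\<lambda>j. U j \<omega>) {i}, V \<omega>)) -` (C \<times> B) \<inter> space M)"
        using s by (auto simp: C_def space_PiM)
    qed
    also have "prob \<dots> = prob ((\<lambda>\<omega>. restrict (\<lambda>j. U j \<omega>) {i}) -` C \<inter> space M)
        * prob (V -` B \<inter> space M)"
      by (rule indep_varD[OF ind C B])
    also have "(\<lambda>\<omega>. restrict (\<lambda>j. U j \<omega>) {i}) -` C \<inter> space M = {\<omega>\<in>space M. U i \<omega> \<le> s}"
      by (auto simp: C_def space_PiM)
    also have "prob \<dots> = s"
      using s t i by (intro prob_U_le) auto
    finally show ?thesis .
  qed
  show ?thesis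
    using eq[of a] eq[of t] a by simp
qed

section \<open>Exponential moments of the count\<close>

lemma integrable_exp_cnt: "integrable M (\<lambda>\<omega>. exp (\<theta> * cnt a \<omega>))"
proof (rule integrable_const_bound[where B = "exp (\<bar>\<theta>\<bar> * card I)"])
  have "\<theta> * cnt a \<omega> \<le> \<bar>\<theta>\<bar> * card I" for \<omega>
  proof -
    obtain m where m: "m \<le> card I" "cnt a \<omega> = real m" by (rule cnt_cases)
    have "\<theta> * real m \<le> \<bar>\<theta>\<bar> * real m" by (intro mult_right_mono) auto
    also have "\<dots> \<le> \<bar>\<theta>\<bar> * card I" using m by (intro mult_left_mono) auto
    finally show ?thesis using m by simp
  qed
  then show "AE \<omega> in M. norm (exp (\<theta> * cnt a \<omega>)) \<le> exp (\<bar>\<theta>\<bar> * card I)"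
    by simp
qed measurable

lemma expectation_exp_cnt:
  assumes a: "0 < a" "a < 1"
  shows "expectation (\<lambda>\<omega>. exp (\<theta> * cnt a \<omega>)) = (1 - a + a * exp \<theta>) ^ card I"
proof -
  have one: "has_bochner_integral M (\<lambda>\<omega>. exp (\<theta> * indicator {..a} (U i \<omega>))) (1 - a + a * exp \<theta>)"
    if i: "i \<in> I" for i
  proof -
    let ?S = "{\<omega>\<in>space M. U i \<omega> \<le> a}"
    have S[measurable]: "?S \<in> events" using i by measurable
    have "has_bochner_integral M (\<lambda>\<omega>. 1 :: real) 1"
      by (simp add: has_bochner_integral_iff prob_space)
    moreover have "has_bochner_integral M (indicator ?S) a"
      using has_bochner_integral_real_indicator[OF S] prob_U_le[OF i a]
      by (simp add: less_top[symmetric])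
    \<comment> \<open>For \<open>b\<close> in {0,1}, \<open>exp (\<theta> * b)\<close> is the affine
      expression \<open>1 + (exp \<theta> - 1) * b\<close>.\<close>
    ultimately have "has_bochner_integral M (\<lambda>\<omega>. 1 + (exp \<theta> - 1) * indicator ?S \<omega>)
        (1 + (exp \<theta> - 1) * a)"
      by (intro has_bochner_integral_add has_bochner_integral_mult_right)
    also have "?this \<longleftrightarrow> ?thesis"
      by (intro has_bochner_integral_cong) (auto simp: indicator_def algebra_simps)
    finally show ?thesis .
  qed
  have "indep_vars (\<lambda>_. borel) (\<lambda>i \<omega>. exp (\<theta> * indicator {..a} (U i \<omega>))) I"
    using indep by (rule indep_vars_compose2) measurable
  then have "expectation (\<lambda>\<omega>. \<Prod>i\<in>I. exp (\<theta> * indicator {..a} (U i \<omega>)))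
      = (\<Prod>i\<in>I. expectation (\<lambda>\<omega>. exp (\<theta> * indicator {..a} (U i \<omega>))))"
    using finite_index one by (intro indep_vars_lebesgue_integral) (auto simp: has_bochner_integral_iff)
  also have "\<dots> = (\<Prod>i\<in>I. 1 - a + a * exp \<theta>)"
    using one by (intro prod.cong) (auto simp: has_bochner_integral_iff)
  finally show ?thesis
    by (simp add: cnt_def exp_sum[OF finite_index] sum_distrib_left del: sum_indicator_eq_card)
qed

section \<open>Maximal inequality, on finite grids and then on intervals\<close>

text \<open>Summed over \<open>i\<close>, thinning shows that the integral of \<open>cnt a\<close>
  over \<open>E (t, m)\<close> is \<open>a * m / t\<close> times its probability. The tangent of
  \<open>exp\<close> at \<open>s * m / t\<close> then bounds
  \<open>exp (s * L) * prob (E (t, m))\<close> by the integral of \<open>W\<close> over this event,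
  and the events are disjoint.\<close>

lemma maximal_inequality_finite:
  assumes a: "0 < a" and T: "finite T" "T \<subseteq> {a..<1}" and s: "0 \<le> s"
  shows "exp (s * L) * prob {\<omega>\<in>space M. \<exists>t\<in>T. L * t < cnt t \<omega>}
    \<le> expectation (\<lambda>\<omega>. exp (s / a * cnt a \<omega>))"
proof -
  define W where "W \<omega> = exp (s / a * cnt a \<omega>)" for \<omega>
  have W_int: "integrable M W"
    unfolding W_def by (rule integrable_exp_cnt)
  \<comment> \<open>\<open>t\<close> is the largest grid point at which the level is exceeded, that
    is, the first exceedance as \<open>t\<close> decreases, and \<open>m\<close> is the count there.
    The exceedance at \<open>t\<close> itself is recorded in \<open>P\<close>.\<close>
  define E where "E = (\<lambda>(t, m). {\<omega>\<in>space M. cnt t \<omega> = real m \<and> (\<forall>u\<in>{u\<in>T. t < u}. cnt u \<omega> \<le> L * u)})"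
  define P where "P = {(t, m). t \<in> T \<and> m \<le> card I \<and> L * t < real m}"
  have "P \<subseteq> T \<times> {..card I}"
    by (auto simp: P_def)
  then have P: "finite P"
    using T(1) finite_subset by blast
  have E_sets: "E p \<in> events" for p
  proof (cases p)
    case (Pair t m)
    have "finite {u\<in>T. t < u}" using T(1) by simp
    then show ?thesis unfolding E_def Pair prod.case by measurable
  qed
  have disj: "disjoint_family_on E P"
    unfolding disjoint_family_on_def
  proof (intro ballI impI equals0I)
    fix p q \<omega>
    assume A: "p \<in> P" "q \<in> P" "p \<noteq> q" "\<omega> \<in> E p \<inter> E q"
    obtain t m t' m' where pq: "p = (t, m)" "q = (t', m')"
      by (metis surj_pair)
    with A have A': "cnt t \<omega> = m" "cnt t' \<omega> = m'" "L * t < m" "L * t' < m'" "t \<in> T" "t' \<in> T"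
      "t < t' \<longrightarrow> cnt t' \<omega> \<le> L * t'" "t' < t \<longrightarrow> cnt t \<omega> \<le> L * t"
      by (auto simp: P_def E_def)
    then have "t = t'"
      by (cases t t' rule: linorder_cases) auto
    then show False
      using A' A(3) pq by simp
  qed
  have Un: "{\<omega>\<in>space M. \<exists>t\<in>T. L * t < cnt t \<omega>} = (\<Union>p\<in>P. E p)"
  proof (intro equalityI subsetI)
    fix \<omega> assume \<omega>: "\<omega> \<in> {\<omega>\<in>space M. \<exists>t\<in>T. L * t < cnt t \<omega>}"
    define T' where "T' = {t\<in>T. L * t < cnt t \<omega>}"
    have T': "finite T'" "T' \<noteq> {}"
      using \<omega> T by (auto simp: T'_def)
    then have max: "Max T' \<in> T'" "\<And>u. u \<in> T' \<Longrightarrow> u \<le> Max T'"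
      by auto
    obtain m where m: "m \<le> card I" "cnt (Max T') \<omega> = real m"
      by (rule cnt_cases)
    have "(Max T', m) \<in> P"
      using max(1) m by (auto simp: P_def T'_def)
    moreover have "cnt u \<omega> \<le> L * u" if "u \<in> T" "Max T' < u" for u
      using max(2)[of u] that by (force simp: T'_def)
    then have "\<omega> \<in> E (Max T', m)"
      using \<omega> m by (auto simp: E_def)
    ultimately show "\<omega> \<in> (\<Union>p\<in>P. E p)" by blast
  qed (force simp: P_def E_def)
  have piece: "exp (s * L) * prob (E p) \<le> expectation (\<lambda>\<omega>. W \<omega> * indicator (E p) \<omega>)"
    if p: "p \<in> P" for p
  proof -
    obtain t m where p_eq: "p = (t, m)" by (cases p)
    have tm: "t \<in> T" "L * t < real m" "a \<le> t" "t < 1" "0 < t"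
      using p p_eq T a by (auto simp: P_def)
    define x where "x = real m / t"
    \<comment> \<open>Thinning applies since \<open>E p\<close> constrains counts only at
      \<open>t\<close> and at larger levels.\<close>
    have thin: "t * prob ({\<omega>\<in>space M. U i \<omega> \<le> a} \<inter> E p) = a * prob ({\<omega>\<in>space M. U i \<omega> \<le> t} \<inter> E p)"
      if "i \<in> I" for i
      unfolding p_eq E_def prod.case using that a tm T by (intro prob_thinning) auto
    have cnt_int: "has_bochner_integral M (\<lambda>\<omega>. cnt u \<omega> * indicator (E p) \<omega>)
        (\<Sum>i\<in>I. prob ({\<omega>\<in>space M. U i \<omega> \<le> u} \<inter> E p))" for u
    proof -
      have "has_bochner_integral M (\<lambda>\<omega>. \<Sum>i\<in>I. indicator ({\<omega>\<in>space M. U i \<omega> \<le> u} \<inter> E p) \<omega>)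
          (\<Sum>i\<in>I. prob ({\<omega>\<in>space M. U i \<omega> \<le> u} \<inter> E p))"
        using E_sets
        by (intro has_bochner_integral_sum has_bochner_integral_real_indicator)
           (auto simp: less_top[symmetric])
      then show ?thesis
        by (rule has_bochner_integral_cong[THEN iffD1, rotated 3])
           (auto simp: cnt_def sum_distrib_right indicator_def intro!: sum.cong)
    qed
    have E_int: "has_bochner_integral M (indicator (E p)) (prob (E p))"
      using E_sets by (intro has_bochner_integral_real_indicator) (auto simp: less_top[symmetric])
    have "(\<Sum>i\<in>I. prob ({\<omega>\<in>space M. U i \<omega> \<le> t} \<inter> E p)) = expectation (\<lambda>\<omega>. cnt t \<omega> * indicator (E p) \<omega>)"
      using cnt_int by (simp add: has_bochner_integral_iff)
    also have "\<dots> = expectation (\<lambda>\<omega>. real m * indicator (E p) \<omega>)"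
      by (intro Bochner_Integration.integral_cong) (auto simp: E_def p_eq indicator_def)
    also have "\<dots> = real m * prob (E p)"
      using E_int by (simp add: has_bochner_integral_iff)
    finally have at_t: "(\<Sum>i\<in>I. prob ({\<omega>\<in>space M. U i \<omega> \<le> t} \<inter> E p)) = real m * prob (E p)" .
    have "t * (\<Sum>i\<in>I. prob ({\<omega>\<in>space M. U i \<omega> \<le> a} \<inter> E p)) = a * (real m * prob (E p))"
      using thin by (simp add: sum_distrib_left flip: at_t)
    then have at_a: "(\<Sum>i\<in>I. prob ({\<omega>\<in>space M. U i \<omega> \<le> a} \<inter> E p)) = a * x * prob (E p)"
      using tm by (simp add: x_def field_simps)
    have "L \<le> x"
      using tm by (simp add: x_def field_simps)
    then have "exp (s * L) * prob (E p) \<le> exp (s * x) * prob (E p)"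
      using s by (intro mult_right_mono) (auto intro: mult_left_mono)
    \<comment> \<open>The factor 1 is split as \<open>(1 - s * x) + s * x\<close>; by
      \<open>at_a\<close> the second part becomes an integral of \<open>cnt a\<close>.\<close>
    also have "\<dots> = exp (s * x) * ((1 - s * x) * prob (E p) + s / a * (a * x * prob (E p)))"
      using a by (simp add: algebra_simps)
    also have "\<dots> = expectation (\<lambda>\<omega>. exp (s * x) *
        ((1 - s * x) * indicator (E p) \<omega> + s / a * (cnt a \<omega> * indicator (E p) \<omega>)))"
      using cnt_int[of a] E_int unfolding at_a
      by (intro has_bochner_integral_integral_eq[symmetric] has_bochner_integral_add
            has_bochner_integral_mult_right)
    also have "\<dots> \<le> expectation (\<lambda>\<omega>. W \<omega> * indicator (E p) \<omega>)"
    proof (rule integral_mono)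
      show "integrable M (\<lambda>\<omega>. exp (s * x) *
        ((1 - s * x) * indicator (E p) \<omega> + s / a * (cnt a \<omega> * indicator (E p) \<omega>)))"
        using cnt_int[of a] E_int
        by (intro integrable_mult_right integrable_add) (auto simp: has_bochner_integral_iff)
      show "integrable M (\<lambda>\<omega>. W \<omega> * indicator (E p) \<omega>)"
        using W_int E_sets by (intro integrable_real_mult_indicator)
      fix \<omega>
      have "exp (s * x) * (1 + (s / a * cnt a \<omega> - s * x)) \<le> exp (s * x) * exp (s / a * cnt a \<omega> - s * x)"
        by (intro mult_left_mono) (auto simp only: exp_ge_add_one_self exp_ge_zero)
      also have "\<dots> = W \<omega>"
        by (simp add: W_def flip: exp_add)
      finally show "exp (s * x) *
        ((1 - s * x) * indicator (E p) \<omega> + s / a * (cnt a \<omega> * indicator (E p) \<omega>)) \<le> W \<omega> * indicator (E p) \<omega>"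
        by (auto simp: indicator_def algebra_simps)
    qed
    finally show ?thesis .
  qed
  have "exp (s * L) * prob (\<Union>p\<in>P. E p) = (\<Sum>p\<in>P. exp (s * L) * prob (E p))"
    using P disj E_sets by (subst finite_measure_finite_Union) (auto simp: sum_distrib_left)
  also have "\<dots> \<le> (\<Sum>p\<in>P. expectation (\<lambda>\<omega>. W \<omega> * indicator (E p) \<omega>))"
    by (intro sum_mono piece)
  also have "\<dots> = expectation (\<lambda>\<omega>. \<Sum>p\<in>P. W \<omega> * indicator (E p) \<omega>)"
    using W_int E_sets
    by (intro Bochner_Integration.integral_sum[symmetric] integrable_real_mult_indicator)
  also have "\<dots> = expectation (\<lambda>\<omega>. W \<omega> * indicator (\<Union>p\<in>P. E p) \<omega>)"
    by (simp add: indicator_UN_disjoint[OF P disj] sum_distrib_left)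
  also have "\<dots> \<le> expectation W"
    using W_int E_sets P
    by (intro integral_mono integrable_real_mult_indicator sets.finite_UN)
       (simp_all add: indicator_def, simp add: W_def)
  finally show ?thesis
    by (simp add: Un W_def[abs_def])
qed

text \<open>A strict exceedance at \<open>t\<close> persists to the right: \<open>cnt\<close> does
  not decrease, and \<open>L * q\<close> stays below \<open>cnt t \<omega>\<close> for
  \<open>q < cnt t \<omega> / L\<close>. Hence countably many levels suffice, both for measurability
  and for the passage from finite grids.\<close>

lemma exceedance_rational:
  assumes L: "0 < L" and ab: "0 < a"
  shows "(\<exists>t\<in>{a..<b}. L * t < cnt t \<omega>) \<longleftrightarrow> (\<exists>t\<in>{a..<b} \<inter> \<rat>. L * t < cnt t \<omega>)"
proof
  assume "\<exists>t\<in>{a..<b}. L * t < cnt t \<omega>"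
  then obtain t where t: "a \<le> t" "t < b" "L * t < cnt t \<omega>" by auto
  then have "t < min b (cnt t \<omega> / L)"
    using L by (simp add: field_simps)
  then obtain q where q: "q \<in> \<rat>" "t < q" "q < min b (cnt t \<omega> / L)"
    using Rats_dense_in_real by blast
  have "L * q < cnt t \<omega>"
    using q L by (simp add: field_simps)
  also have "\<dots> \<le> cnt q \<omega>"
    using q by (intro cnt_mono) auto
  finally show "\<exists>t\<in>{a..<b} \<inter> \<rat>. L * t < cnt t \<omega>"
    using q t by (intro bexI[of _ q]) auto
qed auto

lemma sets_exceedance: "0 < L \<Longrightarrow> 0 < a \<Longrightarrow> {\<omega>\<in>space M. \<exists>t\<in>{a..<b}. L * t < cnt t \<omega>} \<in> events"
  by (simp only: exceedance_rational, intro sets.sets_Collect_countable_Ex') (auto intro: countable_Int2 countable_rat)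

text \<open>Finite grids exhaust the rationals of \<open>[a, 1)\<close>, and continuity of the
  measure along increasing events carries the bound to the limit.\<close>

lemma maximal_inequality:
  assumes a: "0 < a" "a < 1" and s: "0 \<le> s" and L: "0 < L"
  shows "exp (s * L) * prob {\<omega>\<in>space M. \<exists>t\<in>{a..<1}. L * t < cnt t \<omega>}
    \<le> expectation (\<lambda>\<omega>. exp (s / a * cnt a \<omega>))"
proof -
  define Q where "Q = {a..<1} \<inter> \<rat>"
  have "countable Q"
    by (auto simp: Q_def intro: countable_Int2 countable_rat)
  \<comment> \<open>A rational is exhibited because \<open>from_nat_into Q\<close> has range
    \<open>Q\<close> only for nonempty \<open>Q\<close>.\<close>
  moreover obtain q where "q \<in> \<rat>" "a < q" "q < 1"
    using Rats_dense_in_real[OF a(2)] by blast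
  then have "q \<in> Q"
    by (simp add: Q_def)
  then have "Q \<noteq> {}"
    by blast
  ultimately have Q: "range (from_nat_into Q) = Q"
    by (rule range_from_nat_into[rotated])
  define B where "B k = {\<omega>\<in>space M. \<exists>t\<in>from_nat_into Q ` {..k::nat}. L * t < cnt t \<omega>}" for k
  have "B k \<in> events" for k
    unfolding B_def by measurable
  moreover have "incseq B"
    unfolding incseq_def B_def by (auto intro: order_trans)
  ultimately have B: "range B \<subseteq> events" "incseq B"
    by auto
  have "{\<omega>\<in>space M. \<exists>t\<in>{a..<1}. L * t < cnt t \<omega>} = {\<omega>\<in>space M. \<exists>t\<in>range (from_nat_into Q). L * t < cnt t \<omega>}"
    unfolding Q by (simp only: exceedance_rational[OF L a(1)] Q_def)
  also have "\<dots> = (\<Union>k. B k)"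
    by (auto simp: B_def)
  finally have "(\<lambda>k. exp (s * L) * prob (B k))
      \<longlonglongrightarrow> exp (s * L) * prob {\<omega>\<in>space M. \<exists>t\<in>{a..<1}. L * t < cnt t \<omega>}"
    using finite_Lim_measure_incseq[OF B] by (intro tendsto_intros) simp
  then show ?thesis
  proof (rule LIMSEQ_le_const2, intro exI allI impI)
    fix k :: nat
    show "exp (s * L) * prob (B k) \<le> expectation (\<lambda>\<omega>. exp (s / a * cnt a \<omega>))"
      unfolding B_def using a s Q by (intro maximal_inequality_finite) (auto simp: Q_def)
  qed
qed

lemma prob_exceedance_le:
  fixes a l :: real
  assumes a: "0 < a" "a < 1" and l: "1 < l" and I: "I \<noteq> {}"
  shows "prob {\<omega>\<in>space M. \<exists>t\<in>{a..<1}. l * card I * t < cnt t \<omega>} \<le> exp (- (card I * (a / (1 - a)) * h l))"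
    (is "?p \<le> _")
proof -
  define n where "n = card I"
  have n: "n > 0" using I finite_index by (simp add: n_def card_gt_0_iff)
  define c where "c = a / (1 - a)"
  \<comment> \<open>Then \<open>s / a = ln l / (1 - a)\<close>, where the comparison lemma with
    \<open>x = ln l\<close> gives \<open>exp (c * (l - 1))\<close>. The total exponent
    \<open>n * c * (l - 1) - n * c * l * ln l\<close> is \<open>- n * c * h l\<close>; this
    \<open>s\<close> minimises it.\<close>
  define s where "s = c * ln l"
  have s: "0 \<le> s" "s / a = ln l / (1 - a)"
    using a l by (auto simp: s_def c_def)
  have "exp (s * (l * n)) * ?p \<le> expectation (\<lambda>\<omega>. exp (s / a * cnt a \<omega>))"
    using maximal_inequality[OF a s(1), of "l * n"] n l by (simp add: n_def)
  also have "\<dots> = (1 - a + a * exp (ln l / (1 - a))) ^ n"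
    unfolding s(2) n_def by (rule expectation_exp_cnt[OF a])
  also have "\<dots> \<le> exp (c * (exp (ln l) - 1)) ^ n"
    unfolding c_def using a l by (intro power_mono bernoulli_mgf_le_poisson_mgf) auto
  also have "\<dots> = exp (n * (c * (l - 1)))"
    using l by (simp add: exp_of_nat_mult)
  finally have "?p \<le> exp (n * (c * (l - 1))) / exp (s * (l * n))"
    by (simp add: field_simps)
  also have "\<dots> = exp (- (n * c * h l))"
    unfolding exp_diff[symmetric] by (simp add: h_def s_def algebra_simps)
  finally show ?thesis
    by (simp add: n_def c_def)
qed

text \<open>No regularity of \<open>c\<close> is needed: the exceptional set is a finite union, over the set \<open>J\<close> of
  indices counted at the exceedance, of events \<open>\<exists>t\<in>S'. \<forall>i\<in>J. U i \<le> t\<close>, and the lower closure of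
  \<open>S'\<close> is an interval.\<close>

lemma sets_cnt_le:
  fixes c :: "real \<Rightarrow> real"
  shows "{\<omega>\<in>space M. \<forall>t\<in>S. cnt t \<omega> \<le> c t} \<in> events"
proof -
  define S' where "S' J = {t\<in>S. c t < real (card J)}" for J :: "'i set"
  define E where "E J = {\<omega>\<in>space M. \<exists>t\<in>S' J. \<forall>i\<in>J. U i \<omega> \<le> t}" for J
  have E: "E J \<in> events" if J: "J \<subseteq> I" for J
  proof (cases "J = {}")
    \<comment> \<open>Only a nonempty \<open>J\<close> has a maximum; for empty \<open>J\<close> the
      condition does not involve \<open>\<omega>\<close>, so \<open>E J\<close> is empty or the
      whole space.\<close>
    case False
    define D where "D = {x. \<exists>t\<in>S' J. x \<le> t}"
    have fin: "finite J" using J finite_index finite_subset by blast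
    have D: "D \<in> sets borel"
      by (rule real_interval_borel_measurable) (auto simp: D_def is_interval_1, meson order_trans)
    have "E J = {\<omega>\<in>space M. \<forall>i\<in>J. U i \<omega> \<in> D}"
    proof (intro equalityI subsetI)
      fix \<omega> assume \<omega>: "\<omega> \<in> {\<omega>\<in>space M. \<forall>i\<in>J. U i \<omega> \<in> D}"
      \<comment> \<open>Membership in \<open>D\<close> gives each \<open>U i \<omega>\<close> its
        own witness; that of the largest one serves all of \<open>J\<close>.\<close>
      have "Max ((\<lambda>i. U i \<omega>) ` J) \<in> (\<lambda>i. U i \<omega>) ` J"
        using fin False by (intro Max_in) auto
      then obtain t where "t \<in> S' J" "Max ((\<lambda>i. U i \<omega>) ` J) \<le> t"
        using \<omega> by (auto simp: D_def)
      then show "\<omega> \<in> E J"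
        using \<omega> fin False by (auto simp: E_def)
    qed (auto simp: E_def D_def)
    also have "\<dots> \<in> events"
    proof (intro sets.sets_Collect_finite_All' fin False)
      fix i assume "i \<in> J"
      then have "i \<in> I" using J by blast
      then show "{\<omega>\<in>space M. U i \<omega> \<in> D} \<in> events"
        using D by measurable
    qed
    finally show ?thesis .
  qed (auto simp: E_def)
  have "{\<omega>\<in>space M. \<forall>t\<in>S. cnt t \<omega> \<le> c t} = space M - (\<Union>J\<in>Pow I. E J)"
  proof (intro equalityI subsetI)
    fix \<omega> assume \<omega>: "\<omega> \<in> {\<omega>\<in>space M. \<forall>t\<in>S. cnt t \<omega> \<le> c t}"
    have False if J: "J \<subseteq> I" and "\<omega> \<in> E J" for J
    proof -
      obtain t where t: "t \<in> S" "c t < card J" "\<forall>i\<in>J. U i \<omega> \<le> t"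
        using \<open>\<omega> \<in> E J\<close> by (auto simp: E_def S'_def)
      have "card J \<le> card {i\<in>I. U i \<omega> \<le> t}"
        using t J finite_index by (intro card_mono) auto
      then show False
        using \<omega> t by (force simp: cnt_eq_card)
    qed
    then show "\<omega> \<in> space M - (\<Union>J\<in>Pow I. E J)"
      using \<omega> by auto
  next
    fix \<omega> assume \<omega>: "\<omega> \<in> space M - (\<Union>J\<in>Pow I. E J)"
    have "cnt t \<omega> \<le> c t" if "t \<in> S" for t
    proof (rule ccontr)
      assume "\<not> cnt t \<omega> \<le> c t"
      \<comment> \<open>The set of all indices counted at \<open>t\<close> has cardinality
        \<open>cnt t \<omega>\<close>, so \<open>t\<close> lies in its \<open>S'\<close>.\<close>
      then have "\<omega> \<in> E {i\<in>I. U i \<omega> \<le> t}"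
        using that \<omega> by (auto simp: E_def S'_def cnt_eq_card intro!: bexI[of _ t])
      then show False using \<omega> by auto
    qed
    then show "\<omega> \<in> {\<omega>\<in>space M. \<forall>t\<in>S. cnt t \<omega> \<le> c t}"
      using \<omega> by auto
  qed
  also have "\<dots> \<in> events"
    using E finite_index by (intro sets.Diff sets.finite_UN) auto
  finally show ?thesis .
qed

end

section \<open>The inverse of \<open>h\<close> and the dyadic levels\<close>

lemma h_inv_gt_1: "0 < y \<Longrightarrow> 1 < h_inv y"
  using bij_betwE[OF bij_betw_the_inv_into[OF h_bij_betw]] by (auto simp: h_inv_def)

lemma h_h_inv: "0 < y \<Longrightarrow> h (h_inv y) = y"
  using f_the_inv_into_f_bij_betw[OF h_bij_betw, of y] by (simp add: h_inv_def)

lemma h_inv_mono: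
  assumes "0 < x" "x \<le> y"
  shows "h_inv x \<le> h_inv y"
proof (rule ccontr)
  assume "\<not> h_inv x \<le> h_inv y"
  then have "h (h_inv y) < h (h_inv x)"
    using assms h_inv_gt_1 by (intro strict_mono_onD[OF h_strict_mono_on]) auto
  then show False
    using assms by (simp add: h_h_inv)
qed

text \<open>Keeps the logarithm of the level nonnegative and allows the level to be written as
  \<open>Suc k\<close>.\<close>

lemma dyadic_level_ge_1:
  assumes "0 < t" "t < 1"
  shows "1 \<le> dyadic_level t"
proof -
  have "0 < log 2 (1 / t)" using assms by simp
  then show ?thesis unfolding dyadic_level_def by linarith
qed

text \<open>Rounding up adds between 0 and 1 to the exponent. The first bound places
  \<open>t\<close> above the left end point of its level, the second limits the loss to a factor
  2.\<close>

lemma powr_dyadic_level: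
  assumes "0 < t"
  shows "2 powr (- real_of_int (dyadic_level t)) \<le> t" "t / 2 \<le> 2 powr (- real_of_int (dyadic_level t))"
proof -
  have "log 2 (1 / t) \<le> dyadic_level t" "dyadic_level t \<le> log 2 (1 / t) + 1"
    unfolding dyadic_level_def by linarith+
  then have le: "- real_of_int (dyadic_level t) \<le> log 2 t" "log 2 t - 1 \<le> - real_of_int (dyadic_level t)"
    using assms by (simp_all add: log_divide)
  have "2 powr (- real_of_int (dyadic_level t)) \<le> 2 powr (log 2 t)"
    using le(1) by (intro powr_mono) auto
  then show "2 powr (- real_of_int (dyadic_level t)) \<le> t"
    using assms by simp
  have "2 powr (log 2 t - 1) \<le> 2 powr (- real_of_int (dyadic_level t))"
    using le(2) by (intro powr_mono) auto
  then show "t / 2 \<le> 2 powr (- real_of_int (dyadic_level t))"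
    using assms by (simp add: powr_diff)
qed

text \<open>Division by \<open>1 - a\<close>, which lies in (0,1), only enlarges \<open>a\<close>,
  and \<open>a\<close> is at least \<open>t / 2\<close>.\<close>

lemma g_ge:
  assumes t: "0 < t" "t < 1"
  shows "t / 2 \<le> g t"
proof -
  define a where "a = 2 powr (- real_of_int (dyadic_level t))"
  have a: "0 < a" "a \<le> t" "t / 2 \<le> a"
    using powr_dyadic_level[OF t(1)] by (auto simp: a_def)
  then have "a * (1 - a) \<le> a"
    by (intro mult_left_le) auto
  then have "a \<le> a / (1 - a)"
    using a t by (simp add: field_simps)
  then show ?thesis
    using a(3) unfolding g_def a_def by linarith
qed

text \<open>Makes \<open>ln (kappa / \<delta>)\<close> positive, so that \<open>h_inv\<close> is
  only applied inside its domain.\<close>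

lemma kappa_gt_1: "1 < kappa"
proof -
  have "3 * 3 < pi * pi"
    using pi_gt3 by (intro mult_strict_mono) auto
  then show ?thesis
    by (simp add: kappa_def power2_eq_square)
qed

section \<open>Union bound over the dyadic levels\<close>

theorem proposition6:
  fixes M :: "'a measure" and U :: "nat \<Rightarrow> 'a \<Rightarrow> real" and n :: nat and \<delta> :: real
  assumes "prob_space M"
    and "n \<ge> 1"
    and "prob_space.indep_vars M (\<lambda>_. borel) U {1..n}"
    and "\<And>i. i \<in> {1..n} \<Longrightarrow> distr M borel (U i) = uniform_measure lborel {0<..<1}"
    and "0 < \<delta>" and "\<delta> < 1"
  shows "measure M {\<omega> \<in> space M. \<forall>t\<in>{0<..<1}.
           (\<Sum>i=1..n. indicator {..t} (U i \<omega>)) / real n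
             \<le> t * h_inv ((ln (kappa / \<delta>) + 2 * ln (real_of_int (dyadic_level t))) / (real n * g t))}
         \<ge> 1 - \<delta>
    \<and> (\<forall>t\<in>{0<..<1}. g t \<ge> t / 2)
    \<and> measure M {\<omega> \<in> space M. \<forall>t\<in>{0<..<1}.
           (\<Sum>i=1..n. indicator {..t} (U i \<omega>)) / real n
             \<le> t * h_inv ((2 * ln (kappa / \<delta>) + 4 * ln (1 + log 2 (1 / t))) / (real n * t))}
         \<ge> 1 - \<delta>"
    (is "measure M ?G \<ge> _ \<and> _ \<and> measure M ?G' \<ge> _")
proof -
  interpret prob_space M by fact
  interpret uniform_sample M U "{1..n}"
    using assms by unfold_locales auto
  define L where "L = ln (kappa / \<delta>)"
  have L: "0 < L"
    using kappa_gt_1 assms(5,6) by (simp add: L_def)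
  have n: "0 < real n" using assms(2) by simp
  have good_eq: "{\<omega>\<in>space M. \<forall>t\<in>{0<..<1}. (\<Sum>i=1..n. indicator {..t} (U i \<omega>)) / real n \<le> c t}
      = {\<omega>\<in>space M. \<forall>t\<in>{0<..<1}. cnt t \<omega> \<le> c t * real n}" for c
    using n by (simp only: cnt_def[symmetric] pos_divide_le_eq)
  \<comment> \<open>Comparing probabilities by inclusion needs measurable good events; the bound
    \<open>c\<close> is arbitrary, so the jumps of \<open>dyadic_level\<close> do no harm.\<close>
  have good_sets: "{\<omega>\<in>space M. \<forall>t\<in>{0<..<1}. (\<Sum>i=1..n. indicator {..t} (U i \<omega>)) / real n \<le> c t} \<in> events" for c
    unfolding good_eq by (rule sets_cnt_le)

  \<comment> \<open>Index \<open>k\<close> stands for level \<open>k + 1\<close>, so the levels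
    start at 1.\<close>
  define a :: "nat \<Rightarrow> real" where "a k = 2 powr (- real (Suc k))" for k
  have a: "0 < a k" "a k < 1" for k
    unfolding a_def by (auto simp: powr_less_one)
  \<comment> \<open>Chosen so that the exponent \<open>n * (a k / (1 - a k)) * y k\<close> is
    \<open>L + 2 * ln (k + 1)\<close>, which makes the tail bound
    \<open>\<delta> / (kappa * (k + 1)^2)\<close>.\<close>
  define y where "y k = (L + 2 * ln (real (Suc k))) / (real n * (a k / (1 - a k)))" for k
  have y: "0 < y k" for k
    unfolding y_def using L n a[of k] by (intro divide_pos_pos add_pos_nonneg mult_pos_pos) auto
  define B where "B k = {\<omega>\<in>space M. \<exists>t\<in>{a k..<1}. h_inv (y k) * card {1..n} * t < cnt t \<omega>}" for k
  have B_sets: "B k \<in> events" for k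
    unfolding B_def using h_inv_gt_1[OF y[of k]] n a[of k] by (intro sets_exceedance) auto
  have B_prob: "prob (B k) \<le> \<delta> / kappa * (1 / (real k + 1)\<^sup>2)" for k
  proof -
    have "prob (B k) \<le> exp (- (card {1..n} * (a k / (1 - a k)) * h (h_inv (y k))))"
      unfolding B_def using a[of k] h_inv_gt_1[OF y[of k]] assms(2) by (intro prob_exceedance_le) auto
    also have "card {1..n} * (a k / (1 - a k)) * h (h_inv (y k)) = L + 2 * ln (real (Suc k))"
      unfolding h_h_inv[OF y] using n a[of k] by (simp add: y_def)
    also have "exp (- \<dots>) = \<delta> / kappa * (1 / (real k + 1)\<^sup>2)"
    proof -
      have "exp (L + 2 * ln (real (Suc k))) = kappa / \<delta> * (real k + 1)\<^sup>2"
        using kappa_gt_1 assms(5) by (simp add: L_def exp_add exp_double add.commute)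
      then show ?thesis
        by (simp only: exp_minus) simp
    qed
    finally show ?thesis .
  qed
  \<comment> \<open>Euler's sum of the inverse squares is \<open>kappa\<close>, so the total error
    is exactly \<open>\<delta>\<close>.\<close>
  have sums: "(\<lambda>k. \<delta> / kappa * (1 / (real k + 1)\<^sup>2)) sums \<delta>"
    using sums_mult[OF inverse_squares_sums, of "\<delta> / kappa"] kappa_gt_1
    by (simp add: kappa_def add.commute)
  have B_summable: "summable (\<lambda>k. prob (B k))"
    using sums B_prob by (intro summable_comparison_test'[OF sums_summable[OF sums]]) auto
  have "prob (\<Union>k. B k) \<le> (\<Sum>k. prob (B k))"
    using B_sets B_summable by (intro finite_measure_subadditive_countably) auto
  also have "\<dots> \<le> (\<Sum>k. \<delta> / kappa * (1 / (real k + 1)\<^sup>2))"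
    using B_prob B_summable sums by (intro suminf_le) (auto simp: sums_iff)
  also have "\<dots> = \<delta>"
    using sums by (rule sums_unique[symmetric])
  finally have "1 - \<delta> \<le> 1 - prob (\<Union>k. B k)"
    by simp
  also have "\<dots> = prob (space M - (\<Union>k. B k))"
    using B_sets by (intro prob_compl[symmetric]) auto
  \<comment> \<open>Each \<open>t\<close> is handled by its own level: with
    \<open>k + 1 = dyadic_level t\<close>, the point \<open>t\<close> lies in
    \<open>[a k, 1)\<close> and \<open>a k / (1 - a k) = g t\<close>.\<close>
  also have "\<dots> \<le> prob ?G"
  proof (intro finite_measure_mono good_sets subsetI CollectI conjI ballI)
    fix \<omega> t assume \<omega>: "\<omega> \<in> space M - (\<Union>k. B k)" and t: "t \<in> {0<..<1::real}"
    define k where "k = nat (dyadic_level t) - 1"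
    have k: "real_of_int (dyadic_level t) = real (Suc k)"
      using dyadic_level_ge_1[of t] t by (simp add: k_def)
    have "a k \<le> t"
      using powr_dyadic_level(1)[of t] t by (simp only: a_def k) simp
    then have "cnt t \<omega> \<le> h_inv (y k) * n * t"
      using \<omega> t by (force simp: B_def not_less)
    moreover have "y k = (ln (kappa / \<delta>) + 2 * ln (real_of_int (dyadic_level t))) / (real n * g t)"
      by (simp only: y_def L_def g_def a_def k)
    ultimately show "(\<Sum>i=1..n. indicator {..t} (U i \<omega>)) / real n
        \<le> t * h_inv ((ln (kappa / \<delta>) + 2 * ln (real_of_int (dyadic_level t))) / (real n * g t))"
      unfolding cnt_def[symmetric] using n by (simp add: pos_divide_le_eq mult_ac)
  qed auto
  finally have G: "1 - \<delta> \<le> prob ?G" .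
  also have "\<dots> \<le> prob ?G'"
  proof (intro finite_measure_mono good_sets subsetI CollectI conjI ballI)
    fix \<omega> t assume \<omega>: "\<omega> \<in> ?G" and t: "t \<in> {0<..<1::real}"
    define k where "k = real_of_int (dyadic_level t)"
    have k: "1 \<le> k" "k \<le> 1 + log 2 (1 / t)"
      using dyadic_level_ge_1[of t] t unfolding k_def dyadic_level_def by (simp, linarith)
    have g: "t / 2 \<le> g t" "0 < t" "0 < g t"
      using g_ge[of t] t by auto
    \<comment> \<open>The level is at most \<open>1 + log 2 (1 / t)\<close> and \<open>g t\<close>
      at least \<open>t / 2\<close>; clearing this 1/2 doubles the numerator, whence the constants 2
      and 4.\<close>
    have "(L + 2 * ln k) / (real n * g t) \<le> (L + 2 * ln (1 + log 2 (1 / t))) / (real n * (t / 2))"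
      using L k n g t by (intro frac_le mult_left_mono add_mono add_nonneg_nonneg mult_pos_pos) auto
    also have "\<dots> = (2 * L + 4 * ln (1 + log 2 (1 / t))) / (real n * t)"
      using n g by (simp add: field_simps)
    finally have "h_inv ((L + 2 * ln k) / (real n * g t))
        \<le> h_inv ((2 * L + 4 * ln (1 + log 2 (1 / t))) / (real n * t))"
      using L k n g by (intro h_inv_mono divide_pos_pos add_pos_nonneg mult_pos_pos) auto
    then have "t * h_inv ((L + 2 * ln k) / (real n * g t))
        \<le> t * h_inv ((2 * L + 4 * ln (1 + log 2 (1 / t))) / (real n * t))"
      using g by (intro mult_left_mono) auto
    moreover have "(\<Sum>i=1..n. indicator {..t} (U i \<omega>)) / real n \<le> t * h_inv ((L + 2 * ln k) / (real n * g t))"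
      using \<omega> t unfolding L_def k_def by blast
    ultimately show "(\<Sum>i=1..n. indicator {..t} (U i \<omega>)) / real n
        \<le> t * h_inv ((2 * ln (kappa / \<delta>) + 4 * ln (1 + log 2 (1 / t))) / (real n * t))"
      unfolding L_def by (rule order_trans[rotated])
  qed auto
  finally have G': "1 - \<delta> \<le> prob ?G'" .
  show ?thesis
    using G G' g_ge by auto
qed

end
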